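(* There exists a unique fixed point to the following functional equation in $w(z)$: $$\frac1t\,\big(w(z)-z\big)=\widehat G_{\mu^n_t}\big(w(z)\big),\qquad z\in\mathbb{C}_{2\sqrt t}.$$ This fixed point is denoted by $\widehat w^n_{fp}(z)$. We have $\operatorname{Im}\big(\widehat w^n_{fp}(z)\big)>\frac12\operatorname{Im}(z)$ and $\big|\widehat w^n_{fp}(z)-z\big|\le\sqrt t$.
   Context: Fix $t>0$ and $n\ge1$. $\mathbb{C}^+=\{z\in\mathbb{C}:\operatorname{Im}z>0\}$ and $\mathbb{C}_{2\sqrt t}=\{z\in\mathbb{C}^+:\operatorname{Im}z>2\sqrt t\}$. Let $\lambda_1^n(t),\dots,\lambda_n^n(t)\in\mathbb{R}$ be the eigenvalues of the observed $n\times n$ Hermitian matrix $X^n(t)=X^n(0)+H^n(t)$, where $X^n(0)$ is the real diagonal matrix of the order statistics of $n$ i.i.d. real random variables whose common law $\mu_0$ has a density with respect to Lebesgue measure, and $H^n$ is an independent Hermitian Brownian motion, i.e. $H^n(s)$ is Hermitian with $(H^n)_{kl}=\frac1{\sqrt{2n}}(B_{k,l}+i\tilde B_{k,l})$ for $k<l$ and $(H^n)_{kk}=\frac1{\sqrt n}B_{k,k}$, for i.i.d. standard real Brownian motions $B_{k,l},\tilde B_{k,l}$. Let $\mu_t^n=\frac1n\sum_{j=1}^n\delta_{\lambda_j^n(t)}$ be the empirical spectral measure and, for $z\in\mathbb{C}^+$, $\widehat G_{\mu^n_t}(z)=\int_{\mathbb{R}}\frac{d\mu^n_t(\lambda)}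{z-\lambda}=\frac1n\sum_{j=1}^n\frac1{z-\lambda_j^n(t)}$.
   Formalization: Uniqueness of the fixed point is claimed among w with Im w > √t, not on all of C⁺, where it fails: for n=1, eigenvalue 0 and z=iy with y>2√t, both i(y±√(y²−4t))/2 solve the equation. *)

theory Defs
  imports "HOL-Probability.Probability" "Jordan_Normal_Form.Char_Poly"
begin

definition upper_half_plane :: "real \<Rightarrow> complex set" where
  "upper_half_plane a = {z. a < Im z}"

definition has_density :: "real measure \<Rightarrow> bool" where
  "has_density \<mu> \<longleftrightarrow> (\<exists>f. f \<in> borel_measurable lborel \<and> \<mu> = density lborel f)"

definition standard_brownian_motion :: "'w measure \<Rightarrow> (real \<Rightarrow> 'w \<Rightarrow> real) \<Rightarrow> bool" where
  "standard_brownian_motion M B \<longleftrightarrow>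
     (\<forall>s\<ge>0. B s \<in> borel_measurable M) \<and>
     (AE \<omega> in M. B 0 \<omega> = 0) \<and>
     (\<forall>r s. 0 \<le> r \<and> r < s \<longrightarrow>
        distributed M lborel (\<lambda>\<omega>. B s \<omega> - B r \<omega>) (normal_density 0 (sqrt (s - r)))) \<and>
     (\<forall>(m::nat) \<tau>. 0 \<le> \<tau> 0 \<and> (\<forall>i<m. \<tau> i < \<tau> (Suc i)) \<longrightarrow>
        prob_space.indep_vars M (\<lambda>_. borel)
          (\<lambda>i \<omega>. B (\<tau> (Suc i)) \<omega> - B (\<tau> i) \<omega>) {..<m}) \<and>
     (AE \<omega> in M. continuous_on {0..} (\<lambda>s. B s \<omega>))"

(* The driving motions B k l (k \<le> l < n) and Bt k l (k < l < n), indexed as one family;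
   matrix indices start at 0. *)

definition driving_index :: "nat \<Rightarrow> (nat \<times> nat + nat \<times> nat) set" where
  "driving_index n = {(k, l). k \<le> l \<and> l < n} <+> {(k, l). k < l \<and> l < n}"

definition driving_family ::
  "(nat \<Rightarrow> nat \<Rightarrow> 'p) \<Rightarrow> (nat \<Rightarrow> nat \<Rightarrow> 'p) \<Rightarrow> nat \<times> nat + nat \<times> nat \<Rightarrow> 'p" where
  "driving_family B Bt = case_sum (\<lambda>(k, l). B k l) (\<lambda>(k, l). Bt k l)"

definition hermitian_bm ::
  "nat \<Rightarrow> (nat \<Rightarrow> nat \<Rightarrow> real \<Rightarrow> 'w \<Rightarrow> real) \<Rightarrow> (nat \<Rightarrow> nat \<Rightarrow> real \<Rightarrow> 'w \<Rightarrow> real) \<Rightarrow>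
   real \<Rightarrow> 'w \<Rightarrow> complex mat" where
  "hermitian_bm n B Bt s \<omega> = Matrix.mat n n (\<lambda>(k, l).
     if k = l then complex_of_real (B k k s \<omega> / sqrt (real n))
     else if k < l then Complex (B k l s \<omega>) (Bt k l s \<omega>) / complex_of_real (sqrt (2 * real n))
     else cnj (Complex (B l k s \<omega>) (Bt l k s \<omega>) / complex_of_real (sqrt (2 * real n))))"

definition order_statistic :: "nat \<Rightarrow> (nat \<Rightarrow> 'w \<Rightarrow> real) \<Rightarrow> 'w \<Rightarrow> nat \<Rightarrow> real" where
  "order_statistic n \<xi> \<omega> k = sort (map (\<lambda>i. \<xi> i \<omega>) [0..<n]) ! k"

definition initial_matrix :: "nat \<Rightarrow> (nat \<Rightarrow> 'w \<Rightarrow> real) \<Rightarrow> 'w \<Rightarrow> complex mat" where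
  "initial_matrix n \<xi> \<omega> = mat_diag n (\<lambda>k. complex_of_real (order_statistic n \<xi> \<omega> k))"

definition observed_matrix ::
  "nat \<Rightarrow> (nat \<Rightarrow> 'w \<Rightarrow> real) \<Rightarrow> (nat \<Rightarrow> nat \<Rightarrow> real \<Rightarrow> 'w \<Rightarrow> real) \<Rightarrow>
   (nat \<Rightarrow> nat \<Rightarrow> real \<Rightarrow> 'w \<Rightarrow> real) \<Rightarrow> real \<Rightarrow> 'w \<Rightarrow> complex mat" where
  "observed_matrix n \<xi> B Bt t \<omega> = initial_matrix n \<xi> \<omega> + hermitian_bm n B Bt t \<omega>"

definition matrix_model ::
  "'w measure \<Rightarrow> nat \<Rightarrow> real measure \<Rightarrow> (nat \<Rightarrow> 'w \<Rightarrow> real) \<Rightarrow>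
   (nat \<Rightarrow> nat \<Rightarrow> real \<Rightarrow> 'w \<Rightarrow> real) \<Rightarrow> (nat \<Rightarrow> nat \<Rightarrow> real \<Rightarrow> 'w \<Rightarrow> real) \<Rightarrow> bool" where
  "matrix_model M n \<mu>0 \<xi> B Bt \<longleftrightarrow>
     prob_space M \<and>
     prob_space.indep_vars M (\<lambda>_. borel) \<xi> {..<n} \<and>
     (\<forall>k<n. distr M borel (\<xi> k) = \<mu>0) \<and>
     (\<forall>i\<in>driving_index n. standard_brownian_motion M (driving_family B Bt i)) \<and>
     prob_space.indep_vars M (\<lambda>_. \<Pi>\<^sub>M s\<in>{0..}. borel)
       (\<lambda>i \<omega>. \<lambda>s\<in>{0..}. driving_family B Bt i s \<omega>) (driving_index n) \<and>
     prob_space.indep_set M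
       (sets (vimage_algebra (space M)
         (\<lambda>\<omega>. \<lambda>k\<in>{..<n}. order_statistic n \<xi> \<omega> k)
         (\<Pi>\<^sub>M k\<in>{..<n}. borel)))
       (sets (vimage_algebra (space M)
         (\<lambda>\<omega>. \<lambda>i\<in>driving_index n. \<lambda>s\<in>{0..}. driving_family B Bt i s \<omega>)
         (\<Pi>\<^sub>M i\<in>driving_index n. \<Pi>\<^sub>M s\<in>{0..}. borel)))"

(* Eigenvalues listed with algebraic multiplicity. *)

definition real_eigenvalues :: "complex mat \<Rightarrow> nat \<Rightarrow> (nat \<Rightarrow> real) \<Rightarrow> bool" where
  "real_eigenvalues A n lam \<longleftrightarrow>
     A \<in> carrier_mat n n \<and> char_poly A = (\<Prod>j<n. [:- complex_of_real (lam j), 1:])"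

definition empirical_measure :: "nat \<Rightarrow> (nat \<Rightarrow> real) \<Rightarrow> real measure" where
  "empirical_measure n lam = distr (uniform_count_measure {..<n}) borel lam"

lemma emeasure_empirical_measure:
  assumes "n \<ge> 1" and "A \<in> sets borel"
  shows "emeasure (empirical_measure n lam) A =
    (\<Sum>j<n. emeasure (return borel (lam j)) A) / of_nat n"
proof -
  have m: "lam \<in> measurable (uniform_count_measure {..<n}) borel"
    by (simp add: measurable_def sets_uniform_count_measure space_uniform_count_measure)
  have "emeasure (empirical_measure n lam) A =
      emeasure (uniform_count_measure {..<n}) (lam -` A \<inter> {..<n})"
    unfolding empirical_measure_def
    by (subst emeasure_distr[OF m]) (use assms in \<open>auto simp: space_uniform_count_measure\<close>)
  also have "\<dots> = ennreal (real (card (lam -` A \<inter> {..<n})) / real n)"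
    by (subst emeasure_uniform_count_measure) auto
  also have "\<dots> = of_nat (card (lam -` A \<inter> {..<n})) / of_nat n"
    using assms(1) by (simp add: divide_ennreal[symmetric] ennreal_of_nat_eq_real_of_nat)
  also have "(of_nat (card (lam -` A \<inter> {..<n})) :: ennreal) =
      (\<Sum>j<n. emeasure (return borel (lam j)) A)"
    using assms(2) by (simp add: indicator_def sum.If_cases vimage_def Int_def conj_commute)
  finally show ?thesis .
qed

definition cauchy_transform :: "real measure \<Rightarrow> complex \<Rightarrow> complex" where
  "cauchy_transform \<mu> z = (LINT x|\<mu>. 1 / (z - complex_of_real x))"

(* Fixed points are sought in the half-plane Im w > sqrt t.  On all of Im w > 0 uniqueness is
   false: for \<mu> the Dirac mass at 0 and z = \<i> y with y > 2 sqrt t, both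
   w = \<i> (y + sqrt (y^2 - 4 t)) / 2 and w = \<i> (y - sqrt (y^2 - 4 t)) / 2 solve the equation.
   For Im z > 2 sqrt t the half-plane Im w > sqrt t contains Im w > Im z / 2. *)

definition is_fixed_point :: "real \<Rightarrow> real measure \<Rightarrow> complex \<Rightarrow> complex \<Rightarrow> bool" where
  "is_fixed_point t \<mu> z w \<longleftrightarrow>
     w \<in> upper_half_plane (sqrt t) \<and>
     complex_of_real (1 / t) * (w - z) = cauchy_transform \<mu> w"

definition w_fp :: "real \<Rightarrow> real measure \<Rightarrow> complex \<Rightarrow> complex" where
  "w_fp t \<mu> z = (THE w. is_fixed_point t \<mu> z w)"

end

theory Submission
  imports Defs
begin

text \<open>
  A fixed point is a solution of \<open>w = z + t G(w)\<close> with \<open>G\<close> the Cauchy transform of the spectral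
  measure, which is a probability measure on the line. Averaging the kernel \<open>1 / (w - x)\<close> gives
  \<open>|G(w)| \<le> 1 / Im w\<close> and \<open>|G(w) - G(w')| \<le> |w - w'| / (Im w Im w')\<close>, so \<open>w \<mapsto> z + t G(w)\<close> strictly
  decreases distances where \<open>Im w > sqrt t\<close>, which gives uniqueness. The same two bounds show that,
  when \<open>Im z > 2 sqrt t\<close>, the map sends the closed disc of radius \<open>sqrt t\<close> about \<open>z\<close> to itself and
  has a Lipschitz constant below one there. Banach's theorem thus puts the fixed point in that disc,
  and every point \<open>w\<close> of the disc satisfies \<open>Im w \<ge> Im z - sqrt t > Im z / 2\<close>.
\<close>

section \<open>Bounds for the Cauchy transform of a probability measure\<close>

lemma Im_le_norm_diff_of_real: "Im w \<le> cmod (w - complex_of_real x)"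
  using abs_Im_le_cmod[of "w - complex_of_real x"] by simp

lemma cauchy_kernel_norm_le:
  assumes "Im w > 0"
  shows "cmod (1 / (w - complex_of_real x)) \<le> 1 / Im w"
  using Im_le_norm_diff_of_real[of w x] assms by (simp add: norm_divide frac_le)

lemma cauchy_kernel_diff_norm_le:
  assumes "Im w > 0" "Im w' > 0"
  shows "cmod (1 / (w - complex_of_real x) - 1 / (w' - complex_of_real x))
    \<le> cmod (w - w') / (Im w * Im w')"
proof -
  have ne: "w - complex_of_real x \<noteq> 0" "w' - complex_of_real x \<noteq> 0"
    using assms by (auto simp: complex_eq_iff)
  have "1 / (w - complex_of_real x) - 1 / (w' - complex_of_real x) =
      (w' - w) / ((w - complex_of_real x) * (w' - complex_of_real x))"
    using ne by (simp add: diff_frac_eq)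
  also have "cmod \<dots> = cmod (w - w') /
      (cmod (w - complex_of_real x) * cmod (w' - complex_of_real x))"
    by (simp add: norm_divide norm_mult norm_minus_commute)
  also have "\<dots> \<le> cmod (w - w') / (Im w * Im w')"
    using assms by (intro divide_left_mono mult_mono mult_pos_pos Im_le_norm_diff_of_real)
      (use ne in auto)
  finally show ?thesis .
qed

lemma (in prob_space) norm_integral_le_bound:
  fixes f :: "'a \<Rightarrow> complex"
  assumes "\<And>x. cmod (f x) \<le> c" "f \<in> borel_measurable M"
  shows "cmod (LINT x|M. f x) \<le> c"
proof -
  have "integrable M f"
    by (rule integrable_const_bound[of _ c]) (use assms in auto)
  then have "(LINT x|M. cmod (f x)) \<le> c"
    using assms by (intro integral_le_const) auto
  then show ?thesis
    using integral_norm_bound[of M f] by linarith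
qed

lemma cauchy_kernel_measurable:
  assumes "sets \<mu> = sets borel"
  shows "(\<lambda>x. 1 / (w - complex_of_real x)) \<in> borel_measurable \<mu>"
  unfolding measurable_cong_sets[OF assms refl] by measurable

lemma cauchy_transform_norm_le:
  assumes "prob_space \<mu>" "sets \<mu> = sets borel" "Im w > 0"
  shows "cmod (cauchy_transform \<mu> w) \<le> 1 / Im w"
  unfolding cauchy_transform_def using assms
  by (intro prob_space.norm_integral_le_bound cauchy_kernel_norm_le cauchy_kernel_measurable)

lemma cauchy_transform_diff_norm_le:
  assumes "prob_space \<mu>" "sets \<mu> = sets borel" "Im w > 0" "Im w' > 0"
  shows "cmod (cauchy_transform \<mu> w - cauchy_transform \<mu> w') \<le> cmod (w - w') / (Im w * Im w')"
proof -
  interpret prob_space \<mu> by fact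
  have int: "integrable \<mu> (\<lambda>x. 1 / (v - complex_of_real x))" if "Im v > 0" for v
    by (rule integrable_const_bound[of _ "1 / Im v"])
      (use cauchy_kernel_norm_le[OF that] cauchy_kernel_measurable[OF assms(2)] in auto)
  have "cauchy_transform \<mu> w - cauchy_transform \<mu> w' =
      (LINT x|\<mu>. 1 / (w - complex_of_real x) - 1 / (w' - complex_of_real x))"
    unfolding cauchy_transform_def using int assms
    by (intro Bochner_Integration.integral_diff[symmetric]) auto
  also have "cmod \<dots> \<le> cmod (w - w') / (Im w * Im w')"
    by (intro norm_integral_le_bound cauchy_kernel_diff_norm_le borel_measurable_diff
        cauchy_kernel_measurable assms)
  finally show ?thesis .
qed

section \<open>The fixed point\<close>

lemma is_fixed_point_iff:
  assumes "t > 0"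
  shows "is_fixed_point t \<mu> z w \<longleftrightarrow>
    sqrt t < Im w \<and> z + complex_of_real t * cauchy_transform \<mu> w = w"
  using assms by (auto simp: is_fixed_point_def upper_half_plane_def field_simps)

text \<open>
  Where both imaginary parts exceed \<open>sqrt t\<close>, their product exceeds \<open>t\<close>, so subtracting the two
  equations would make the distance of distinct solutions smaller than itself.
\<close>

lemma is_fixed_point_unique:
  assumes "t > 0" "prob_space \<mu>" "sets \<mu> = sets borel"
    and w: "is_fixed_point t \<mu> z w" and w': "is_fixed_point t \<mu> z w'"
  shows "w = w'"
proof (rule ccontr)
  assume "w \<noteq> w'"
  have Im: "sqrt t < Im w" "sqrt t < Im w'"
    and eq: "z + complex_of_real t * cauchy_transform \<mu> w = w"
      "z + complex_of_real t * cauchy_transform \<mu> w' = w'"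
    using w w' assms(1) by (auto simp: is_fixed_point_iff)
  have pos: "Im w > 0" "Im w' > 0"
    using Im real_sqrt_gt_zero[OF assms(1)] by linarith+
  have "t < Im w * Im w'"
    using mult_strict_mono[OF Im] pos assms(1) by simp
  have "w - w' =
      (z + complex_of_real t * cauchy_transform \<mu> w) - (z + complex_of_real t * cauchy_transform \<mu> w')"
    by (simp only: eq)
  also have "\<dots> = complex_of_real t * (cauchy_transform \<mu> w - cauchy_transform \<mu> w')"
    by (simp add: algebra_simps)
  finally have "cmod (w - w') = t * cmod (cauchy_transform \<mu> w - cauchy_transform \<mu> w')"
    using assms(1) by (metis abs_of_pos norm_mult norm_of_real)
  also have "\<dots> \<le> t * (cmod (w - w') / (Im w * Im w'))"
    using assms pos by (intro mult_left_mono cauchy_transform_diff_norm_le) auto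
  also have "\<dots> < cmod (w - w')"
    using \<open>t < Im w * Im w'\<close> \<open>w \<noteq> w'\<close> pos by (simp add: field_simps)
  finally show False by simp
qed

text \<open>
  With \<open>d = Im z - sqrt t > sqrt t\<close> the lowest height of the disc, the map moves the disc to within
  \<open>t / d < sqrt t\<close> of \<open>z\<close> and has Lipschitz constant \<open>t / d\<^sup>2 < 1\<close> on it.
\<close>

lemma is_fixed_point_exists_in_disc:
  assumes "t > 0" "prob_space \<mu>" "sets \<mu> = sets borel" "2 * sqrt t < Im z"
  shows "\<exists>w. is_fixed_point t \<mu> z w \<and> cmod (w - z) \<le> sqrt t"
proof -
  define d where "d = Im z - sqrt t"
  define F where "F = (\<lambda>w. z + complex_of_real t * cauchy_transform \<mu> w)"
  have "sqrt t > 0" "sqrt t < d"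
    using assms by (auto simp: d_def)
  then have "d > 0" by linarith
  have d2: "t < d * d"
    using mult_strict_mono[OF \<open>sqrt t < d\<close> \<open>sqrt t < d\<close>] \<open>d > 0\<close> assms(1) by simp
  have low: "d \<le> Im w" if "w \<in> cball z (sqrt t)" for w
    using that abs_Im_le_cmod[of "z - w"] by (simp add: d_def dist_norm)
  have maps: "F w \<in> cball z (sqrt t)" if "w \<in> cball z (sqrt t)" for w
  proof -
    have "cmod (cauchy_transform \<mu> w) \<le> 1 / Im w"
      using low[OF that] \<open>d > 0\<close> assms by (intro cauchy_transform_norm_le) auto
    also have "\<dots> \<le> 1 / sqrt t"
      using low[OF that] \<open>sqrt t < d\<close> \<open>sqrt t > 0\<close> by (intro frac_le) auto
    finally have "t * cmod (cauchy_transform \<mu> w) \<le> t * (1 / sqrt t)"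
      using assms(1) by (intro mult_left_mono) auto
    also have "\<dots> = sqrt t"
      using assms(1) by (simp add: real_div_sqrt)
    finally show ?thesis
      using assms(1) by (simp add: F_def dist_norm norm_mult)
  qed
  have contr: "dist (F w) (F w') \<le> t / (d * d) * dist w w'"
    if "w \<in> cball z (sqrt t)" "w' \<in> cball z (sqrt t)" for w w'
  proof -
    have Im: "d \<le> Im w" "d \<le> Im w'"
      using low that by auto
    have "dist (F w) (F w') = t * cmod (cauchy_transform \<mu> w - cauchy_transform \<mu> w')"
      using assms(1) by (simp add: F_def dist_norm norm_mult flip: right_diff_distrib)
    also have "\<dots> \<le> t * (cmod (w - w') / (Im w * Im w'))"
      using assms Im \<open>d > 0\<close> by (intro mult_left_mono cauchy_transform_diff_norm_le) auto
    also have "\<dots> \<le> t * (cmod (w - w') / (d * d))"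
      using assms(1) Im \<open>d > 0\<close> by (intro mult_left_mono divide_left_mono mult_mono) auto
    finally show ?thesis
      by (simp add: dist_norm)
  qed
  have "\<exists>!w\<in>cball z (sqrt t). F w = w"
    using maps contr \<open>sqrt t > 0\<close> \<open>d > 0\<close> d2 assms(1)
    by (intro Banach_fix[of _ "t / (d * d)"]) (auto simp: complete_eq_closed)
  then obtain w where w: "w \<in> cball z (sqrt t)" "F w = w"
    by blast
  have "sqrt t < Im w"
    using low[OF w(1)] \<open>sqrt t < d\<close> by linarith
  then show ?thesis
    using w assms(1) by (auto simp: F_def is_fixed_point_iff dist_norm norm_minus_commute)
qed

lemma prob_space_empirical_measure:
  assumes "n \<ge> 1"
  shows "prob_space (empirical_measure n lam)"
proof -
  have "prob_space (uniform_count_measure {..<n})"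
    using assms by (intro prob_space_uniform_count_measure) (auto simp: lessThan_empty_iff)
  then show ?thesis
    unfolding empirical_measure_def
    by (rule prob_space.prob_space_distr)
      (simp add: measurable_def sets_uniform_count_measure space_uniform_count_measure)
qed

theorem mainTheorem2:
  fixes M :: "'w measure" and n :: nat and t :: real and \<mu>0 :: "real measure"
    and \<xi> :: "nat \<Rightarrow> 'w \<Rightarrow> real"
    and B Bt :: "nat \<Rightarrow> nat \<Rightarrow> real \<Rightarrow> 'w \<Rightarrow> real"
    and \<Lambda> :: "'w \<Rightarrow> nat \<Rightarrow> real" and \<omega> :: 'w and z :: complex
  assumes "t > 0" and "n \<ge> 1"
    and "has_density \<mu>0"
    and "matrix_model M n \<mu>0 \<xi> B Bt"
    and "\<And>\<omega>. \<omega> \<in> space M \<Longrightarrow> real_eigenvalues (observed_matrix n \<xi> B Bt t \<omega>) n (\<Lambda> \<omega>)"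
    and "\<omega> \<in> space M"
    and "z \<in> upper_half_plane (2 * sqrt t)"
  shows "(\<exists>!w. is_fixed_point t (empirical_measure n (\<Lambda> \<omega>)) z w) \<and>
    Im (w_fp t (empirical_measure n (\<Lambda> \<omega>)) z) > 1 / 2 * Im z \<and>
    cmod (w_fp t (empirical_measure n (\<Lambda> \<omega>)) z - z) \<le> sqrt t"
proof -
  let ?\<mu> = "empirical_measure n (\<Lambda> \<omega>)"
  have \<mu>: "prob_space ?\<mu>" "sets ?\<mu> = sets borel"
    using prob_space_empirical_measure[OF assms(2)] by (simp_all add: empirical_measure_def)
  have z: "2 * sqrt t < Im z"
    using assms(7) by (simp add: upper_half_plane_def)
  obtain w where w: "is_fixed_point t ?\<mu> z w" "cmod (w - z) \<le> sqrt t"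
    using is_fixed_point_exists_in_disc[OF assms(1) \<mu> z] by blast
  have uniq: "w' = w" if "is_fixed_point t ?\<mu> z w'" for w'
    using is_fixed_point_unique[OF assms(1) \<mu> that w(1)] .
  have "w_fp t ?\<mu> z = w"
    unfolding w_fp_def using w(1) uniq by (rule the_equality)
  moreover have "Im w > 1 / 2 * Im z"
    using abs_Im_le_cmod[of "w - z"] w(2) z by simp
  ultimately show ?thesis
    using w uniq by blast
qed

end
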